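(* For every even integer $n\ge 4$, the graph $UQI(n,2)$ (which is isomorphic to the complete graph $K_{\frac12\binom{n}{n/2}}$) is a core of $QI(n,2)$.
   Context: For $n\ge 4$, $QI(n,2)$ is the graph whose vertices are all partitions $\{A_1,A_2\}$ of $\{1,\dots,n\}$ into two classes, each of size at least $2$; two vertices $\{A_1,A_2\}$, $\{B_1,B_2\}$ are adjacent if and only if $A_i\cap B_j\ne\emptyset$ for all $i,j\in\{1,2\}$. For $n$ even, $UQI(n,2)$ is the subgraph of $QI(n,2)$ induced by the uniform partitions, i.e. those with both classes of size $n/2$. A graph is a core if every endomorphism of it (homomorphism to itself) is an automorphism. A core of a graph $G$ is a subgraph $G^\bullet$ of $G$ such that $G^\bullet$ is a core and there is a graph homomorphism $G\to G^\bullet$. *)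

theory Defs
  imports "Graph_Theory.Graph_Theory" "HOL-Library.Disjoint_Sets"
begin

text \<open>
  As usual in \<^theory>\<open>Graph_Theory.Digraph\<close>, an undirected simple graph is a digraph
  satisfying \<^const>\<open>graph\<close>: finite, loop-free, symmetric and without parallel arcs.
  Homomorphisms and automorphisms are given by their vertex maps and expressed through the
  adjacency relation, which determines such a graph.
\<close>

definition graph_hom :: "('a \<Rightarrow> 'c) \<Rightarrow> ('a,'b) pre_digraph \<Rightarrow> ('c,'d) pre_digraph \<Rightarrow> bool" where
  "graph_hom f G H \<longleftrightarrow>
     f ` verts G \<subseteq> verts H \<and> (\<forall>u v. u \<rightarrow>\<^bsub>G\<^esub> v \<longrightarrow> f u \<rightarrow>\<^bsub>H\<^esub> f v)"

definition graph_automorphism :: "('a \<Rightarrow> 'a) \<Rightarrow> ('a,'b) pre_digraph \<Rightarrow> bool" where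
  "graph_automorphism f G \<longleftrightarrow>
     bij_betw f (verts G) (verts G) \<and>
     (\<forall>u\<in>verts G. \<forall>v\<in>verts G. u \<rightarrow>\<^bsub>G\<^esub> v \<longleftrightarrow> f u \<rightarrow>\<^bsub>G\<^esub> f v)"

definition is_core :: "('a,'b) pre_digraph \<Rightarrow> bool" where
  "is_core G \<longleftrightarrow> graph G \<and> (\<forall>f. graph_hom f G G \<longrightarrow> graph_automorphism f G)"

definition is_core_of :: "('a,'b) pre_digraph \<Rightarrow> ('a,'b) pre_digraph \<Rightarrow> bool" where
  "is_core_of C G \<longleftrightarrow>
     graph G \<and> subgraph C G \<and> is_core C \<and> (\<exists>f. graph_hom f G C)"

definition QI2_verts :: "nat \<Rightarrow> nat set set set" where
  "QI2_verts n = {P. partition_on {1..n} P \<and> card P = 2 \<and> (\<forall>A\<in>P. 2 \<le> card A)}"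

definition QI2 :: "nat \<Rightarrow> (nat set set, nat set set \<times> nat set set) pre_digraph" where
  "QI2 n = with_proj
     \<lparr> pverts = QI2_verts n,
       parcs = {(P, Q). P \<in> QI2_verts n \<and> Q \<in> QI2_verts n \<and>
                        (\<forall>A\<in>P. \<forall>B\<in>Q. A \<inter> B \<noteq> {})} \<rparr>"

text \<open>Only meaningful for even \<open>n\<close>.\<close>

definition UQI2 :: "nat \<Rightarrow> (nat set set, nat set set \<times> nat set set) pre_digraph" where
  "UQI2 n = QI2 n \<restriction> {P \<in> verts (QI2 n). \<forall>A\<in>P. card A = n div 2}"

definition complete_graph :: "nat \<Rightarrow> (nat, nat \<times> nat) pre_digraph" where
  "complete_graph m = with_proj
     \<lparr> pverts = {..<m}, parcs = {(i, j). i < m \<and> j < m \<and> i \<noteq> j} \<rparr>"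

end

theory Submission
  imports Defs
begin

text \<open>
  Write \<open>n = 2 k\<close>. Two different partitions of \<open>{1..n}\<close> into classes of size \<open>k\<close> are always
  adjacent, because a class of one that misses a class of the other must be its complement. So the
  uniform partitions induce a finite complete graph, and a finite complete graph is a core: an
  endomorphism sends distinct vertices to distinct vertices, hence is a bijection.

  The point is to retract the whole graph onto this clique. A partition is determined by its class
  avoiding the element \<open>n\<close>, which is a subset of the \<open>2 k - 1\<close> elements of \<open>{1..<n}\<close>, and two
  partitions are adjacent only if these subsets are incomparable. Decompose the subsets of
  \<open>{1..<n}\<close> into symmetric chains, that is, chains that contain one set of each size from \<open>j\<close> to
  \<open>2 k - 1 - j\<close> for some \<open>j\<close>. Since \<open>2 k - 1\<close> is odd, \<open>j < k\<close>, so every chain contains a set of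
  size \<open>k\<close>. Send each subset to the set of size \<open>k\<close> in its chain. Subsets with
  the same image are comparable, so adjacent partitions have different images, and different
  uniform partitions are adjacent: this is a homomorphism (\<open>middle_layer_colouring\<close>,
  \<open>QI2_retracts_to_UQI2\<close>).

  The same encoding counts the uniform partitions: there are \<open>n - 1 choose k\<close> of them, which is
  half of \<open>n choose k\<close> by Pascal's rule and symmetry.
\<close>

section \<open>Symmetric chain decompositions\<close>

text \<open>
  A decomposition is encoded by the function \<open>b\<close> that sends a set to the smallest member of its
  chain, so that the chains are the fibres of \<open>b\<close>. Symmetry of a chain about the middle layer says
  that its sizes run from \<open>card (b A)\<close> to \<open>card S - card (b A)\<close>, none omitted.
\<close>

definition symmetric_chains :: "'a set \<Rightarrow> ('a set \<Rightarrow> 'a set) \<Rightarrow> bool" where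
  "symmetric_chains S b \<longleftrightarrow>
     (\<forall>A\<subseteq>S. b A \<subseteq> A \<and> card A + card (b A) \<le> card S \<and>
        (\<forall>i. card (b A) \<le> i \<and> i + card (b A) \<le> card S \<longrightarrow>
           (\<exists>B\<subseteq>S. card B = i \<and> b B = b A))) \<and>
     (\<forall>A\<subseteq>S. \<forall>B\<subseteq>S. b A = b B \<longrightarrow> A \<subseteq> B \<or> B \<subseteq> A)"

lemma symmetric_chainsD:
  assumes "symmetric_chains S b" and "A \<subseteq> S"
  shows "b A \<subseteq> A" and "card A + card (b A) \<le> card S"
    and "card (b A) \<le> i \<Longrightarrow> i + card (b A) \<le> card S \<Longrightarrow> \<exists>B\<subseteq>S. card B = i \<and> b B = b A"
    and "B \<subseteq> S \<Longrightarrow> b A = b B \<Longrightarrow> A \<subseteq> B \<or> B \<subseteq> A"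
  using assms unfolding symmetric_chains_def by simp_all

text \<open>
  When a new point \<open>x\<close> is added, each chain \<open>C\<close> gives rise to two: \<open>C\<close> extended by
  \<open>insert x\<close> of its largest member, and the sets \<open>insert x A\<close> for the other members \<open>A\<close> of \<open>C\<close>
  (none if \<open>C\<close> has just one member). The largest member is recognised by its size, which together
  with the size of the smallest gives \<open>card S\<close>; this makes the recursion for \<open>b\<close> explicit.
\<close>

lemma symmetric_chain_decomposition:
  assumes "finite S"
  shows "\<exists>b. symmetric_chains S b"
  using assms
proof (induction S rule: finite_induct)
  case empty
  show ?case by (rule exI[of _ "\<lambda>_. {}"]) (simp add: symmetric_chains_def)
next
  case (insert x S)
  then obtain b where b: "symmetric_chains S b" by blast
  note sub = symmetric_chainsD(1)[OF b] and le = symmetric_chainsD(2)[OF b]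
    and full = symmetric_chainsD(3)[OF b] and chain = symmetric_chainsD(4)[OF b]
  have xS: "x \<notin> S" by fact
  have fin: "finite A" if "A \<subseteq> S" for A using that \<open>finite S\<close> finite_subset by blast
  have xb: "x \<notin> b A" if "A \<subseteq> S" for A using sub[OF that] that xS by blast
  define b' where "b' A = (if x \<notin> A then b A
      else if card (A - {x}) + card (b (A - {x})) = card S then b (A - {x})
      else insert x (b (A - {x})))" for A
  have b'_old: "b' A = b A" if "A \<subseteq> S" for A
    using that xS by (auto simp: b'_def)
  have b'_top: "b' (insert x A) = b A" if "A \<subseteq> S" "card A + card (b A) = card S" for A
    using that Diff_insert_absorb[OF contra_subsetD[OF that(1) xS]] by (simp add: b'_def)
  have b'_new: "b' (insert x A) = insert x (b A)"
    if "A \<subseteq> S" "card A + card (b A) \<noteq> card S" for A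
    using that Diff_insert_absorb[OF contra_subsetD[OF that(1) xS]] by (simp add: b'_def)
  have cards: "card (insert x A) = Suc (card A)" "card (insert x (b A)) = Suc (card (b A))"
    if "A \<subseteq> S" for A
    using contra_subsetD[OF that xS] fin[OF that] xb[OF that]
      finite_subset[OF sub[OF that] fin[OF that]] by simp_all
  have cardS: "card (insert x S) = Suc (card S)" using xS \<open>finite S\<close> by simp
  have cases: "\<exists>A'\<subseteq>S. A = A' \<or>
      A = insert x A' \<and> card A' + card (b A') = card S \<or>
      A = insert x A' \<and> card A' + card (b A') < card S" if "A \<subseteq> insert x S" for A
  proof -
    have S: "A - {x} \<subseteq> S" and "A = A - {x} \<or> A = insert x (A - {x})" using that by auto
    then show ?thesis using le[OF S] by (intro exI[of _ "A - {x}"]) linarith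
  qed
  (* A set B whose size and bottom size add up to card S is the top of its chain. *)
  have below_top: "A \<subseteq> B"
    if "A \<subseteq> S" "B \<subseteq> S" "b A = b B" "card B + card (b B) = card S" for A B
  proof -
    have "card A \<le> card B" using le[OF that(1)] that(3,4) by simp
    then show ?thesis using chain[OF that(1,2,3)] card_seteq[OF fin[OF that(1)], of B] by blast
  qed
  have levels: "b' A \<subseteq> A \<and> card A + card (b' A) \<le> card (insert x S) \<and>
        (\<forall>i. card (b' A) \<le> i \<and> i + card (b' A) \<le> card (insert x S) \<longrightarrow>
           (\<exists>B\<subseteq>insert x S. card B = i \<and> b' B = b' A))" if A: "A \<subseteq> insert x S" for A
  proof -
    obtain A' where A': "A' \<subseteq> S" and
      c: "A = A' \<or> A = insert x A' \<and> card A' + card (b A') = card S \<or>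
          A = insert x A' \<and> card A' + card (b A') < card S"
      using cases[OF A] by blast
    have long: "\<exists>B\<subseteq>insert x S. card B = i \<and> b' B = b A'"
      if i: "card (b A') \<le> i" "i + card (b A') \<le> Suc (card S)" for i
    proof (cases "i + card (b A') \<le> card S")
      case True
      then show ?thesis using full[OF A' i(1)] b'_old by (metis subset_insertI2)
    next
      case False
      (* The new top size: adjoin x to the old top member. *)
      then have i': "i + card (b A') = Suc (card S)" using i by simp
      have "card (b A') \<le> card A'" using sub[OF A'] fin[OF A'] card_mono by blast
      then have "card (b A') \<le> i - 1" "(i - 1) + card (b A') = card S" "i = Suc (i - 1)"
        using le[OF A'] i' by linarith+
      then obtain B where B: "B \<subseteq> S" "card B = i - 1" "b B = b A'"
        using full[OF A', of "i - 1"] by auto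
      have "card (insert x B) = i" using cards(1)[OF B(1)] B(2) \<open>i = Suc (i - 1)\<close> by simp
      moreover have "b' (insert x B) = b A'"
        using b'_top[OF B(1)] B \<open>(i - 1) + card (b A') = card S\<close> by simp
      ultimately show ?thesis using B(1) by (intro exI[of _ "insert x B"]) auto
    qed
    have short: "\<exists>B\<subseteq>insert x S. card B = i \<and> b' B = insert x (b A')"
      if i: "Suc (card (b A')) \<le> i" "i + Suc (card (b A')) \<le> Suc (card S)" for i
    proof -
      have "card (b A') \<le> i - 1" "(i - 1) + card (b A') \<le> card S" using i by linarith+
      then obtain B where B: "B \<subseteq> S" "card B = i - 1" "b B = b A'"
        using full[OF A', of "i - 1"] by blast
      have "b' (insert x B) = insert x (b A')" using b'_new[OF B(1)] B i by simp
      moreover have "card (insert x B) = i" using cards(1)[OF B(1)] B(2) i by simp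
      ultimately show ?thesis using B(1) by (intro exI[of _ "insert x B"]) auto
    qed
    from c show ?thesis
    proof (elim disjE conjE)
      assume "A = A'"
      then show ?thesis using b'_old[OF A'] sub[OF A'] le[OF A'] cardS long by auto
    next
      assume "A = insert x A'" and top: "card A' + card (b A') = card S"
      then show ?thesis using b'_top[OF A' top] sub[OF A'] cardS cards[OF A'] long by auto
    next
      assume "A = insert x A'" and "card A' + card (b A') < card S"
      then show ?thesis using b'_new[OF A'] sub[OF A'] cardS cards[OF A'] short by auto
    qed
  qed
  have chain': "A \<subseteq> B \<or> B \<subseteq> A"
    if A: "A \<subseteq> insert x S" and B: "B \<subseteq> insert x S" and eq: "b' A = b' B" for A B
  proof -
    obtain A' where A': "A' \<subseteq> S" and
      cA: "A = A' \<or> A = insert x A' \<and> card A' + card (b A') = card S \<or>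
          A = insert x A' \<and> card A' + card (b A') < card S"
      using cases[OF A] by blast
    obtain B' where B': "B' \<subseteq> S" and
      cB: "B = B' \<or> B = insert x B' \<and> card B' + card (b B') = card S \<or>
          B = insert x B' \<and> card B' + card (b B') < card S"
      using cases[OF B] by blast
    note [simp] = b'_old[OF A'] b'_old[OF B'] b'_top[OF A'] b'_top[OF B']
      b'_new[OF A'] b'_new[OF B']
    (* The point x lies in the bottom of exactly the chains of the second kind. *)
    have ab: "b A' = b B'"
      using cA cB eq xb[OF A'] xb[OF B'] insert_ident[OF xb[OF A'] xb[OF B']] by auto
    (* Only a set in S and a lengthening insert x T of the same chain need more than the
       induction hypothesis: T is the top member, so it contains the former. *)
    note below = below_top[OF A' B' ab] below_top[OF B' A' ab[symmetric]]
    show ?thesis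
      using cA cB eq xb[OF A'] xb[OF B'] chain[OF A' B' ab] below ab by auto
  qed
  have "symmetric_chains (insert x S) b'"
    unfolding symmetric_chains_def using levels chain' by simp
  then show ?case by blast
qed

text \<open>
  In an odd cube every symmetric chain passes through the layer just above the middle, as its
  smallest member is strictly smaller than that.
\<close>

lemma middle_layer_colouring:
  assumes "finite S" and "card S = 2 * k - 1" and "k > 0"
  obtains c where "\<forall>A\<subseteq>S. c A \<subseteq> S \<and> card (c A) = k"
    and "\<forall>A\<subseteq>S. \<forall>B\<subseteq>S. c A = c B \<longrightarrow> A \<subseteq> B \<or> B \<subseteq> A"
proof -
  obtain b where b: "symmetric_chains S b"
    using symmetric_chain_decomposition[OF assms(1)] by blast
  note sub = symmetric_chainsD(1)[OF b] and le = symmetric_chainsD(2)[OF b]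
    and full = symmetric_chainsD(3)[OF b] and chain = symmetric_chainsD(4)[OF b]
  have "\<exists>B\<subseteq>S. card B = k \<and> b B = b A" if A: "A \<subseteq> S" for A
  proof -
    have "card (b A) \<le> card A"
      using sub[OF A] finite_subset[OF A assms(1)] card_mono by blast
    then show ?thesis using full[OF A, of k] le[OF A] assms(2,3) by simp
  qed
  then obtain c where c: "\<And>A. A \<subseteq> S \<Longrightarrow> c A \<subseteq> S \<and> card (c A) = k \<and> b (c A) = b A"
    by metis
  show ?thesis
  proof
    show "\<forall>A\<subseteq>S. c A \<subseteq> S \<and> card (c A) = k" using c by simp
    show "\<forall>A\<subseteq>S. \<forall>B\<subseteq>S. c A = c B \<longrightarrow> A \<subseteq> B \<or> B \<subseteq> A"
      using chain c by metis
  qed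
qed

section \<open>Partitions encoded by the class avoiding the last element\<close>

definition bipartition :: "nat \<Rightarrow> nat set \<Rightarrow> nat set set" where
  "bipartition n A = {A, {1..n} - A}"

text \<open>Just one class of a two-class partition avoids \<open>x\<close>, and the union extracts it.\<close>

definition class_avoiding :: "'a \<Rightarrow> 'a set set \<Rightarrow> 'a set" where
  "class_avoiding x P = \<Union>{A \<in> P. x \<notin> A}"

lemma class_avoiding_bipartition:
  assumes "n > 0" and "A \<subseteq> {1..<n}"
  shows "class_avoiding n (bipartition n A) = A"
proof -
  have "n \<notin> A" "n \<in> {1..n} - A" using assms by auto
  then have "{X \<in> bipartition n A. n \<notin> X} = {A}" unfolding bipartition_def by blast
  then show ?thesis by (simp add: class_avoiding_def)
qed

lemma card_complement:
  assumes "A \<subseteq> {1..<n}"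
  shows "card ({1..n} - A) = n - card A"
proof -
  have "A \<subseteq> {1..n}" using assms by auto
  then show ?thesis by (simp add: card_Diff_subset finite_subset)
qed

lemma bipartition_in_QI2_verts:
  assumes "n > 0" and "A \<subseteq> {1..<n}" and "2 \<le> card A" and "2 \<le> n - card A"
  shows "bipartition n A \<in> QI2_verts n"
proof -
  have "A \<noteq> {}" "n \<notin> A" "A \<subseteq> {1..n}" using assms by auto
  moreover have "n \<in> {1..n} - A" using assms by auto
  ultimately show ?thesis
    using assms card_complement[OF assms(2)]
    by (auto simp: QI2_verts_def bipartition_def partition_on_def disjoint_def card_insert_if)
qed

lemma QI2_verts_bipartitionE:
  assumes "P \<in> QI2_verts n" and "n > 0"
  obtains A where "A \<subseteq> {1..<n}" and "P = bipartition n A"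
proof -
  have part: "partition_on {1..n} P" and "card P = 2"
    using assms by (auto simp: QI2_verts_def)
  obtain X Y where XY: "P = {X, Y}" "X \<noteq> Y"
    using \<open>card P = 2\<close> by (auto simp: card_2_iff)
  have un: "X \<union> Y = {1..n}" "X \<inter> Y = {}"
    using part XY by (auto simp: partition_on_def disjoint_def)
  define A where "A = (if n \<in> X then Y else X)"
  have "A \<subseteq> {1..n}" "n \<notin> A" using un assms(2) by (auto simp: A_def)
  then have A: "A \<subseteq> {1..<n}" by (force simp: order_less_le)
  have "P = bipartition n A" unfolding XY bipartition_def A_def un(1)[symmetric]
    using un(2) by auto
  then show ?thesis by (rule that[OF A])
qed

lemma QI2_simps:
  "verts (QI2 n) = QI2_verts n"
  "P \<rightarrow>\<^bsub>QI2 n\<^esub> Q \<longleftrightarrow> P \<in> QI2_verts n \<and> Q \<in> QI2_verts n \<and> (\<forall>A\<in>P. \<forall>B\<in>Q. A \<inter> B \<noteq> {})"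
  "arcs (QI2 n) = arcs_ends (QI2 n)" "tail (QI2 n) = fst" "head (QI2 n) = snd"
  by (simp_all add: QI2_def)

text \<open>
  If \<open>A \<subseteq> B\<close>, then \<open>A\<close> misses the complement of \<open>B\<close>, which is a class of the other partition.
\<close>

lemma adjacent_bipartitions_incomparable:
  assumes "bipartition n A \<rightarrow>\<^bsub>QI2 n\<^esub> bipartition n B"
  shows "\<not> A \<subseteq> B" and "\<not> B \<subseteq> A"
proof -
  have "A \<inter> ({1..n} - B) \<noteq> {}" "({1..n} - A) \<inter> B \<noteq> {}"
    using assms by (simp_all add: QI2_simps(2) bipartition_def)
  then show "\<not> A \<subseteq> B" "\<not> B \<subseteq> A" by blast+
qed

lemma graph_QI2: "graph (QI2 n)"
proof -
  have "QI2_verts n \<subseteq> Pow (Pow {1..n})"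
    by (auto simp: QI2_verts_def partition_on_def)
  then have fin: "finite (QI2_verts n)" by (rule finite_subset) simp
  (* Distinct classes of one partition are disjoint, so no partition is adjacent to itself. *)
  have irrefl: "\<exists>A\<in>P. \<exists>B\<in>P. A \<inter> B = {}" if "P \<in> QI2_verts n" for P
  proof -
    have "disjoint P" "card P = 2" using that by (auto simp: QI2_verts_def partition_on_def)
    then obtain X Y where "P = {X, Y}" "X \<noteq> Y" by (auto simp: card_2_iff)
    then have "X \<in> P" "Y \<in> P" "X \<inter> Y = {}"
      using \<open>disjoint P\<close> by (simp_all add: disjoint_def)
    then show ?thesis by (intro bexI)
  qed
  note ends = QI2_simps(4,5)
  have arcsD: "fst e \<in> QI2_verts n" "snd e \<in> QI2_verts n"
      "\<forall>A\<in>fst e. \<forall>B\<in>snd e. A \<inter> B \<noteq> {}" if "e \<in> arcs (QI2 n)" for e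
    using that by (simp_all add: QI2_def case_prod_beta)
  have "arcs (QI2 n) \<subseteq> QI2_verts n \<times> QI2_verts n"
    using arcsD(1,2) by (simp add: subset_iff mem_Times_iff)
  then have fin_arcs: "finite (arcs (QI2 n))" by (rule finite_subset) (simp add: fin)
  have "(Q, P) \<in> arcs_ends (QI2 n)" if "(P, Q) \<in> arcs_ends (QI2 n)" for P Q
  proof -
    have "P \<in> QI2_verts n" "Q \<in> QI2_verts n" "\<forall>A\<in>P. \<forall>B\<in>Q. A \<inter> B \<noteq> {}"
      using that by (simp_all add: QI2_simps(2))
    moreover from this(3) have "\<forall>B\<in>Q. \<forall>A\<in>P. B \<inter> A \<noteq> {}" by blast
    ultimately show ?thesis unfolding QI2_simps(2) by (intro conjI)
  qed
  then have sym: "symmetric (QI2 n)" unfolding symmetric_def by (rule symI)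
  show ?thesis
  proof unfold_locales
    show "tail (QI2 n) e \<noteq> head (QI2 n) e" if "e \<in> arcs (QI2 n)" for e
    proof
      assume "tail (QI2 n) e = head (QI2 n) e"
      then have "fst e = snd e" by (simp add: ends)
      then show False using irrefl[OF arcsD(1)[OF that]] arcsD(3)[OF that] by metis
    qed
    show "e = e'" if "arc_to_ends (QI2 n) e = arc_to_ends (QI2 n) e'" for e e'
      using that by (simp add: arc_to_ends_def ends prod_eq_iff)
    show "finite (verts (QI2 n))" "finite (arcs (QI2 n))"
      using fin fin_arcs by (simp_all add: QI2_simps(1))
  qed (simp_all only: sym QI2_simps(1) ends arcsD)
qed

section \<open>The uniform partitions form a complete graph\<close>

lemma UQI2_simps:
  "verts (UQI2 n) = {P \<in> QI2_verts n. \<forall>A\<in>P. card A = n div 2}"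
  "arcs (UQI2 n) = {(P, Q). P \<rightarrow>\<^bsub>QI2 n\<^esub> Q \<and> P \<in> verts (UQI2 n) \<and> Q \<in> verts (UQI2 n)}"
  "tail (UQI2 n) = fst" "head (UQI2 n) = snd"
proof -
  show verts: "verts (UQI2 n) = {P \<in> QI2_verts n. \<forall>A\<in>P. card A = n div 2}"
    by (simp add: UQI2_def QI2_simps(1))
  show "tail (UQI2 n) = fst" "head (UQI2 n) = snd"
    by (simp_all add: UQI2_def QI2_simps(4,5))
  have "arcs (UQI2 n) =
      {e \<in> arcs (QI2 n). fst e \<in> verts (UQI2 n) \<and> snd e \<in> verts (UQI2 n)}"
    by (simp only: UQI2_def induce_subgraph_arcs induce_subgraph_verts QI2_simps(4,5))
  also have "\<dots> = {(P, Q). P \<rightarrow>\<^bsub>QI2 n\<^esub> Q \<and> P \<in> verts (UQI2 n) \<and> Q \<in> verts (UQI2 n)}"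
    by (simp only: QI2_simps(3) set_eq_iff split_paired_All mem_Collect_eq case_prod_conv
        fst_conv snd_conv simp_thms)
  finally show "arcs (UQI2 n) =
      {(P, Q). P \<rightarrow>\<^bsub>QI2 n\<^esub> Q \<and> P \<in> verts (UQI2 n) \<and> Q \<in> verts (UQI2 n)}" .
qed

lemma verts_UQI2:
  assumes "even n" and "n \<ge> 4"
  shows "bij_betw (bipartition n) {A. A \<subseteq> {1..<n} \<and> card A = n div 2} (verts (UQI2 n))"
proof (rule bij_betw_imageI)
  show "inj_on (bipartition n) {A. A \<subseteq> {1..<n} \<and> card A = n div 2}"
    by (rule inj_on_inverseI[of _ "class_avoiding n"])
      (use assms class_avoiding_bipartition in auto)
  have half: "n - n div 2 = n div 2" using assms(1) by presburger
  have into: "bipartition n A \<in> verts (UQI2 n)" if "A \<subseteq> {1..<n}" "card A = n div 2" for A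
    using bipartition_in_QI2_verts[OF _ that(1)] card_complement[OF that(1)] that(2) half assms
    by (auto simp: UQI2_simps bipartition_def)
  have onto: "P \<in> bipartition n ` {A. A \<subseteq> {1..<n} \<and> card A = n div 2}"
    if P: "P \<in> verts (UQI2 n)" for P
  proof -
    have "P \<in> QI2_verts n" "n > 0" using P assms by (simp_all add: UQI2_simps(1))
    then obtain A where A: "A \<subseteq> {1..<n}" "P = bipartition n A"
      by (rule QI2_verts_bipartitionE)
    moreover have "card A = n div 2" using P A(2) by (simp add: UQI2_simps(1) bipartition_def)
    ultimately show ?thesis by (intro image_eqI[of _ _ A]) simp_all
  qed
  show "bipartition n ` {A. A \<subseteq> {1..<n} \<and> card A = n div 2} = verts (UQI2 n)"
  proof (rule equalityI)
    show "bipartition n ` {A. A \<subseteq> {1..<n} \<and> card A = n div 2} \<subseteq> verts (UQI2 n)"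
      by (rule image_subsetI) (simp only: mem_Collect_eq into)
  qed (rule subsetI, rule onto)
qed

text \<open>
  A set of size \<open>n / 2\<close> that misses another one is its complement, by counting; hence the two
  partitions agree as soon as one class misses another.
\<close>

lemma uniform_partitions_adjacent:
  assumes "even n" and P: "P \<in> verts (UQI2 n)" and Q: "Q \<in> verts (UQI2 n)" and "P \<noteq> Q"
  shows "P \<rightarrow>\<^bsub>QI2 n\<^esub> Q"
proof -
  have verts: "P \<in> QI2_verts n" "Q \<in> QI2_verts n" using P Q by (simp_all add: UQI2_simps(1))
  have two_classes: "R = {A, {1..n} - A}" if "R \<in> QI2_verts n" "A \<in> R" for R A
  proof -
    have part: "partition_on {1..n} R" and "card R = 2" using that by (auto simp: QI2_verts_def)
    then obtain X Y where XY: "R = {X, Y}" "X \<noteq> Y" by (auto simp: card_2_iff)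
    then have "X \<union> Y = {1..n}" "X \<inter> Y = {}"
      using part by (auto simp: partition_on_def disjoint_def)
    then show ?thesis using XY that(2) by auto
  qed
  have "A \<inter> B \<noteq> {}" if "A \<in> P" "B \<in> Q" for A B
  proof
    assume disj: "A \<inter> B = {}"
    have sub: "A \<subseteq> {1..n}" "B \<subseteq> {1..n}"
      using verts that by (auto simp: QI2_verts_def partition_on_def)
    have "card A = n div 2" "card B = n div 2" using P Q that by (auto simp: UQI2_simps)
    then have "card ({1..n} - A) = card B"
      using sub \<open>even n\<close> by (simp add: card_Diff_subset finite_subset) presburger
    then have "B = {1..n} - A" using sub disj card_subset_eq[of "{1..n} - A" B] by auto
    then have "{A, {1..n} - A} = {B, {1..n} - B}" using sub by auto
    then show False using two_classes[OF verts(1) that(1)] two_classes[OF verts(2) that(2)]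
      \<open>P \<noteq> Q\<close> by simp
  qed
  then show ?thesis using verts by (simp add: QI2_simps)
qed

lemma subgraph_UQI2: "subgraph (UQI2 n) (QI2 n)"
proof -
  interpret graph "QI2 n" by (rule graph_QI2)
  show ?thesis unfolding UQI2_def
    by (intro induced_imp_subgraph induced_induce) simp
qed

lemma graph_UQI2: "graph (UQI2 n)"
proof -
  interpret graph "QI2 n" by (rule graph_QI2)
  interpret U: digraph "UQI2 n" by (rule digraph_subgraph[OF subgraph_UQI2])
  have "sym (arcs_ends (QI2 n))" using sym_arcs by (simp add: symmetric_def)
  then have "symmetric (UQI2 n)"
    by (auto simp: symmetric_def arcs_ends_conv UQI2_simps sym_def)
  then show ?thesis by (rule U.graphI)
qed

lemma UQI2_complete:
  assumes "even n"
  shows "P \<rightarrow>\<^bsub>UQI2 n\<^esub> Q \<longleftrightarrow> P \<in> verts (UQI2 n) \<and> Q \<in> verts (UQI2 n) \<and> P \<noteq> Q"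
proof -
  interpret graph "UQI2 n" by (rule graph_UQI2)
  have "P \<rightarrow>\<^bsub>UQI2 n\<^esub> Q \<longleftrightarrow> P \<rightarrow>\<^bsub>QI2 n\<^esub> Q \<and> P \<in> verts (UQI2 n) \<and> Q \<in> verts (UQI2 n)"
    by (auto simp: arcs_ends_conv UQI2_simps image_iff)
  then show ?thesis using uniform_partitions_adjacent[OF assms] adj_not_same by blast
qed

text \<open>
  An endomorphism of a complete graph is injective, since the graph has no loops, and an injection
  of a finite vertex set into itself is a bijection.
\<close>

lemma complete_is_core:
  assumes "graph G"
    and complete: "\<And>u v. u \<rightarrow>\<^bsub>G\<^esub> v \<longleftrightarrow> u \<in> verts G \<and> v \<in> verts G \<and> u \<noteq> v"
  shows "is_core G"
proof -
  interpret graph G by fact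
  have "graph_automorphism f G" if f: "graph_hom f G G" for f
  proof -
    have into: "f ` verts G \<subseteq> verts G" and inj: "inj_on f (verts G)"
      using f complete by (auto simp: graph_hom_def inj_on_def)
    then have "f ` verts G = verts G" using endo_inj_surj finite_verts by blast
    then show ?thesis using inj complete into
      by (auto simp: graph_automorphism_def bij_betw_def dest: inj_onD)
  qed
  then show ?thesis using assms by (simp add: is_core_def)
qed

section \<open>The retraction\<close>

text \<open>
  Adjacent partitions have incomparable encodings, so the colouring by sets of size \<open>n / 2\<close>
  separates them.
\<close>

lemma QI2_retracts_to_UQI2:
  assumes "even n" and "n \<ge> 4"
  shows "\<exists>f. graph_hom f (QI2 n) (UQI2 n)"
proof -
  have n: "n > 0" using assms by simp
  have card: "card {1..<n} = 2 * (n div 2) - 1" and pos: "n div 2 > 0" using assms by auto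
  obtain c where
    c_layer: "\<forall>A\<subseteq>{1..<n}. c A \<subseteq> {1..<n} \<and> card (c A) = n div 2" and
    c_chain: "\<forall>A\<subseteq>{1..<n}. \<forall>B\<subseteq>{1..<n}. c A = c B \<longrightarrow> A \<subseteq> B \<or> B \<subseteq> A"
    using middle_layer_colouring[OF finite_atLeastLessThan card pos] .
  note c = c_layer[rule_format] and chain = c_chain[rule_format]
  define f where "f P = bipartition n (c (class_avoiding n P))" for P
  have f: "f (bipartition n A) = bipartition n (c A)" if "A \<subseteq> {1..<n}" for A
    by (simp add: f_def class_avoiding_bipartition[OF n that])
  note bij = verts_UQI2[OF assms]
  have into: "f P \<in> verts (UQI2 n)" if P: "P \<in> QI2_verts n" for P
  proof -
    obtain A where "A \<subseteq> {1..<n}" "P = bipartition n A"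
      using QI2_verts_bipartitionE[OF P n] .
    then show ?thesis using f c bij_betwE[OF bij] by simp
  qed
  have "f P \<noteq> f Q" if adj: "P \<rightarrow>\<^bsub>QI2 n\<^esub> Q" for P Q
  proof
    assume eq: "f P = f Q"
    have "P \<in> QI2_verts n" "Q \<in> QI2_verts n" using adj by (auto simp: QI2_simps)
    obtain A where A: "A \<subseteq> {1..<n}" "P = bipartition n A"
      using QI2_verts_bipartitionE[OF \<open>P \<in> QI2_verts n\<close> n] .
    obtain B where B: "B \<subseteq> {1..<n}" "Q = bipartition n B"
      using QI2_verts_bipartitionE[OF \<open>Q \<in> QI2_verts n\<close> n] .
    have "c A = c B"
      using eq f A B c inj_onD[OF bij_betw_imp_inj_on[OF bij], of "c A" "c B"] by simp
    then have "A \<subseteq> B \<or> B \<subseteq> A" by (rule chain[OF A(1) B(1)])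
    then show False using adjacent_bipartitions_incomparable adj[unfolded A(2) B(2)] by blast
  qed
  then have "graph_hom f (QI2 n) (UQI2 n)"
    using into by (auto simp: graph_hom_def UQI2_complete[OF assms(1)] QI2_simps(1,2))
  then show ?thesis by (intro exI[of _ f])
qed

section \<open>Isomorphism with the complete graph\<close>

lemma half_central_binomial:
  assumes "k > 0"
  shows "(2 * k choose k) div 2 = (2 * k - 1) choose k"
proof -
  obtain j where k: "k = Suc j" using assms gr0_implies_Suc by blast
  have "Suc (2 * j) choose j = Suc (2 * j) choose Suc j"
    using binomial_symmetric[of j "Suc (2 * j)"] by simp
  then show ?thesis by (simp add: k)
qed

lemma card_verts_UQI2:
  assumes "even n" and "n \<ge> 4"
  shows "card (verts (UQI2 n)) = (n choose (n div 2)) div 2"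
proof -
  have "card (verts (UQI2 n)) = (n - 1) choose (n div 2)"
    using bij_betw_same_card[OF verts_UQI2[OF assms]] n_subsets[of "{1..<n}" "n div 2"] by simp
  moreover have "2 * (n div 2) = n" "n div 2 > 0" using assms by auto
  ultimately show ?thesis using half_central_binomial[of "n div 2"] by metis
qed

lemma UQI2_iso_complete_graph:
  assumes "even n"
  shows "digraph_iso (UQI2 n) (complete_graph (card (verts (UQI2 n))))"
proof -
  interpret graph "UQI2 n" by (rule graph_UQI2)
  obtain h where h: "bij_betw h (verts (UQI2 n)) {..<card (verts (UQI2 n))}"
    using ex_bij_betw_finite_nat[OF finite_verts] by (auto simp: atLeast0LessThan)
  then have inj: "inj_on h (verts (UQI2 n))"
    and im: "h ` verts (UQI2 n) = {..<card (verts (UQI2 n))}"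
    by (auto simp: bij_betw_def)
  have arcs: "arcs (UQI2 n) = {(P, Q). P \<in> verts (UQI2 n) \<and> Q \<in> verts (UQI2 n) \<and> P \<noteq> Q}"
    using UQI2_complete[OF assms] by (auto simp: arcs_ends_conv UQI2_simps(3,4) image_iff)
  let ?iso = "\<lparr> iso_verts = h, iso_arcs = map_prod h h, iso_head = snd, iso_tail = fst \<rparr>"
  have "digraph_isomorphism ?iso"
    unfolding digraph_isomorphism_def
    using inj wf_digraph by (auto simp: arcs UQI2_simps(3,4) inj_on_def)
  moreover have "map_prod h h ` arcs (UQI2 n) =
      {(i, j). i < card (verts (UQI2 n)) \<and> j < card (verts (UQI2 n)) \<and> i \<noteq> j}"
  proof -
    have "map_prod h h ` arcs (UQI2 n) =
        {(i, j). i \<in> h ` verts (UQI2 n) \<and> j \<in> h ` verts (UQI2 n) \<and> i \<noteq> j}"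
      using inj by (force simp: arcs image_iff dest: inj_onD)
    then show ?thesis by (simp add: im)
  qed
  then have "complete_graph (card (verts (UQI2 n))) = app_iso ?iso (UQI2 n)"
    by (simp add: complete_graph_def with_proj_def app_iso_def im)
  ultimately show ?thesis unfolding digraph_iso_def by blast
qed

theorem theorem5p3p9:
  fixes n :: nat
  assumes "even n" and "n \<ge> 4"
  shows "is_core_of (UQI2 n) (QI2 n) \<and>
         digraph_iso (UQI2 n) (complete_graph ((n choose (n div 2)) div 2))"
  using graph_QI2 subgraph_UQI2 QI2_retracts_to_UQI2[OF assms]
    complete_is_core[OF graph_UQI2 UQI2_complete[OF assms(1)]]
    UQI2_iso_complete_graph[OF assms(1)]
  by (simp add: is_core_of_def card_verts_UQI2[OF assms])

end
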